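(* Let $A$ be a complex $n\times n$ matrix whose eigenvalues are all real. Let $\lambda_{\min}(A)$ and $\lambda_{\max}(A)$ be the smallest and largest eigenvalues of $A$ and let $B=A-\frac{\operatorname{tr}A}{n}I$. Then $$\lambda_{\min}(A)\le \frac{\operatorname{tr}A}{n}-\left(\frac{n^2-3n+3}{n^3(n-1)^3}\right)^{1/4}\frac{\operatorname{tr}B^2}{(\operatorname{tr}B^4)^{1/4}}$$ and $$\lambda_{\max}(A)\ge \frac{\operatorname{tr}A}{n}+\left(\frac{n^2-3n+3}{n^3(n-1)^3}\right)^{1/4}\frac{\operatorname{tr}B^2}{(\operatorname{tr}B^4)^{1/4}}.$$
   Context: $I$ is the $n\times n$ identity matrix and $\operatorname{tr}$ denotes the trace. The matrix $A$ is not assumed to be Hermitian. *)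

theory Defs
  imports "Jordan_Normal_Form.Spectral_Radius"
begin

definition mat_trace :: "'a :: comm_monoid_add mat \<Rightarrow> 'a" where
  "mat_trace A = (\<Sum>i<dim_row A. A $$ (i, i))"

text \<open>The next two definitions are meant for matrices of positive dimension with real
  spectrum. Then the real part only converts the eigenvalues from type complex to the
  linearly ordered type real.\<close>

definition lambda_min :: "complex mat \<Rightarrow> real" where
  "lambda_min A = Min (Re ` spectrum A)"

definition lambda_max :: "complex mat \<Rightarrow> real" where
  "lambda_max A = Max (Re ` spectrum A)"

end

theory Submission
  imports Defs "HOL-Analysis.Convex"
begin

text \<open>After triangularization, everything concerns real numbers \<open>x\<^sub>1, \<dots>, x\<^sub>n\<close> with sum zero,
  the eigenvalues of \<open>B\<close>; let \<open>m\<close> and \<open>M\<close> be the least and the greatest.  Summing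
  \<open>(M - x\<^sub>i) (x\<^sub>i - m) \<ge> 0\<close> gives \<open>\<Sum>x\<^sub>i\<^sup>2 \<le> - n m M\<close>.  The numbers other than \<open>m\<close> sum to \<open>- m\<close>, so
  the power mean inequality gives \<open>\<Sum>x\<^sub>i\<^sup>4 \<ge> (1 + 1 / (n - 1)\<^sup>3) m\<^sup>4\<close>.  Eliminating \<open>m\<close>
  bounds \<open>M\<close> from below; the bound for \<open>m\<close> follows by negating all \<open>x\<^sub>i\<close>.\<close>

section \<open>Power sums of finite families of real numbers\<close>

text \<open>Cauchy-Schwarz against the constant 1, used twice: first for \<open>x\<close>, then for
  the squares of \<open>x\<close>.\<close>

lemma sum_power4_le:
  fixes x :: "'a \<Rightarrow> real"
  shows "(\<Sum>i\<in>I. x i) ^ 4 \<le> real (card I) ^ 3 * (\<Sum>i\<in>I. x i ^ 4)"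
proof -
  have CS: "(\<Sum>i\<in>I. y i)\<^sup>2 \<le> real (card I) * (\<Sum>i\<in>I. (y i)\<^sup>2)" for y :: "'a \<Rightarrow> real"
    using sum_squared_le_sum_of_squares[of y I] by (simp add: mult.commute)
  have "(\<Sum>i\<in>I. x i) ^ 4 = ((\<Sum>i\<in>I. x i)\<^sup>2)\<^sup>2"
    by simp
  also have "\<dots> \<le> (real (card I) * (\<Sum>i\<in>I. (x i)\<^sup>2))\<^sup>2"
    by (intro power_mono CS) auto
  also have "\<dots> = real (card I) ^ 2 * (\<Sum>i\<in>I. (x i)\<^sup>2)\<^sup>2"
    by (simp add: power_mult_distrib)
  also have "\<dots> \<le> real (card I) ^ 2 * (real (card I) * (\<Sum>i\<in>I. ((x i)\<^sup>2)\<^sup>2))"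
    by (intro mult_left_mono CS) auto
  also have "\<dots> = real (card I) ^ 3 * (\<Sum>i\<in>I. x i ^ 4)"
    by (simp add: power2_eq_square[of "real (card I)"] power3_eq_cube)
  finally show ?thesis .
qed

text \<open>The polynomial in the final constant arises here:
  \<open>n * (n\<^sup>2 - 3 * n + 3)\<close> equals \<open>(n - 1) ^ 3 + 1\<close>. The factor
  \<open>(n - 1) ^ 3\<close> comes from \<open>sum_power4_le\<close> for the \<open>n - 1\<close>
  other entries. Without division the case \<open>n = 1\<close> is included.\<close>

lemma power4_le_sum_power4_of_sum_zero:
  fixes x :: "'a \<Rightarrow> real"
  assumes "finite I" "j \<in> I" "(\<Sum>i\<in>I. x i) = 0"
  defines "n \<equiv> real (card I)"
  shows "n * (n\<^sup>2 - 3 * n + 3) * x j ^ 4 \<le> (n - 1) ^ 3 * (\<Sum>i\<in>I. x i ^ 4)"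
proof -
  have split: "(\<Sum>i\<in>I. f i) = f j + (\<Sum>i\<in>I - {j}. f i)" for f :: "'a \<Rightarrow> real"
    using assms by (simp add: sum.remove)
  have "card I > 0"
    using assms card_gt_0_iff by blast
  hence card: "real (card (I - {j})) = n - 1"
    using assms by (simp add: of_nat_diff)
  have "(\<Sum>i\<in>I - {j}. x i) = - x j"
    using split[of x] assms(3) by linarith
  hence "x j ^ 4 = (\<Sum>i\<in>I - {j}. x i) ^ 4"
    by simp
  also have "\<dots> \<le> (n - 1) ^ 3 * (\<Sum>i\<in>I - {j}. x i ^ 4)"
    using sum_power4_le[of x "I - {j}"] by (simp only: card)
  finally have "x j ^ 4 + (n - 1) ^ 3 * x j ^ 4 \<le> (n - 1) ^ 3 * (\<Sum>i\<in>I. x i ^ 4)"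
    by (simp add: split[of "\<lambda>i. x i ^ 4"] distrib_left)
  moreover have "x j ^ 4 + (n - 1) ^ 3 * x j ^ 4 = n * (n\<^sup>2 - 3 * n + 3) * x j ^ 4"
    by (simp add: power2_eq_square power3_eq_cube algebra_simps)
  ultimately show ?thesis
    by simp
qed

lemma sum_squares_le_of_sum_zero:
  fixes x :: "'a \<Rightarrow> real"
  assumes "(\<Sum>i\<in>I. x i) = 0" "\<And>i. i \<in> I \<Longrightarrow> m \<le> x i" "\<And>i. i \<in> I \<Longrightarrow> x i \<le> M"
  shows "(\<Sum>i\<in>I. (x i)\<^sup>2) \<le> - (real (card I) * M * m)"
proof -
  have "0 \<le> (\<Sum>i\<in>I. (M - x i) * (x i - m))"
    using assms by (intro sum_nonneg mult_nonneg_nonneg) auto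
  also have "\<dots> = (\<Sum>i\<in>I. (M + m) * x i - (x i)\<^sup>2 - M * m)"
    by (intro sum.cong) (auto simp: algebra_simps power2_eq_square)
  also have "\<dots> = - (\<Sum>i\<in>I. (x i)\<^sup>2) - real (card I) * M * m"
    using assms(1) by (simp add: sum_subtractf flip: sum_distrib_left)
  finally show ?thesis
    by simp
qed

text \<open>Taking any upper bound \<open>M\<close>, not the maximum itself, lets the lemma apply to
  a family and to its negation alike.\<close>

lemma upper_bound_of_sum_zero_ge:
  fixes x :: "'a \<Rightarrow> real"
  assumes "finite I" "I \<noteq> {}" "(\<Sum>i\<in>I. x i) = 0" "\<And>i. i \<in> I \<Longrightarrow> x i \<le> M"
  defines "n \<equiv> real (card I)"
  shows "root 4 ((n\<^sup>2 - 3 * n + 3) / (n ^ 3 * (n - 1) ^ 3))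
           * ((\<Sum>i\<in>I. (x i)\<^sup>2) / root 4 (\<Sum>i\<in>I. x i ^ 4)) \<le> M"
proof -
  define S2 where "S2 = (\<Sum>i\<in>I. (x i)\<^sup>2)"
  define S4 where "S4 = (\<Sum>i\<in>I. x i ^ 4)"
  define q where "q = n\<^sup>2 - 3 * n + 3"
  have S2: "S2 \<ge> 0" and S4: "S4 \<ge> 0"
    unfolding S2_def S4_def by (auto intro!: sum_nonneg)
  have q: "q > 0"
  proof -
    have "q = (n - 3/2)\<^sup>2 + 3/4"
      unfolding q_def by (simp add: power2_eq_square algebra_simps)
    thus ?thesis
      using zero_le_power2[of "n - 3/2"] by linarith
  qed
  have "card I > 0"
    using assms card_gt_0_iff by blast
  hence n: "n \<ge> 1"
    unfolding n_def by simp
  \<comment> \<open>A sum of zero forces \<open>M\<close> to be nonnegative, so that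
    \<open>root 4 (M ^ 4)\<close> is \<open>M\<close> at the end.\<close>
  have "0 \<le> n * M"
    using sum_bounded_above[of I x M] assms by simp
  hence M: "M \<ge> 0"
    using n by (simp add: zero_le_mult_iff)
  \<comment> \<open>The lower bound must be attained, since the fourth power estimate concerns a
    member of the family.\<close>
  have "Min (x ` I) \<in> x ` I"
    using assms(1,2) by (intro Min_in) auto
  then obtain j where "j \<in> I" "x j = Min (x ` I)"
    by (metis imageE)
  hence j: "j \<in> I" "\<And>i. i \<in> I \<Longrightarrow> x j \<le> x i"
    using assms(1) by auto
  have "S2 \<le> - (n * M * x j)"
    unfolding S2_def n_def using assms j by (intro sum_squares_le_of_sum_zero) auto
  \<comment> \<open>The fourth power removes the sign and produces \<open>x j ^ 4\<close>, which can
    then be eliminated.\<close>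
  hence "S2 ^ 4 \<le> (- (n * M * x j)) ^ 4"
    using S2 by (intro power_mono)
  also have "\<dots> = n ^ 4 * M ^ 4 * x j ^ 4"
    by (simp add: power_mult_distrib)
  finally have "q * S2 ^ 4 \<le> q * (n ^ 4 * M ^ 4 * x j ^ 4)"
    using q by (intro mult_left_mono) auto
  also have "\<dots> = n ^ 3 * M ^ 4 * (n * q * x j ^ 4)"
    using power_Suc2[of n 3] by (simp add: ac_simps)
  also have "\<dots> \<le> n ^ 3 * M ^ 4 * ((n - 1) ^ 3 * S4)"
    unfolding S4_def q_def n_def
    using assms j by (intro mult_left_mono power4_le_sum_power4_of_sum_zero) auto
  finally have main: "q * S2 ^ 4 \<le> M ^ 4 * (n ^ 3 * (n - 1) ^ 3 * S4)"
    by (simp only: ac_simps)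
  have "q / (n ^ 3 * (n - 1) ^ 3) * (S2 ^ 4 / S4) \<le> M ^ 4"
  \<comment> \<open>If \<open>n = 1\<close> or \<open>S4 = 0\<close>, a quotient on the left has
    denominator zero, hence value 0, and the claim is trivial.\<close>
  proof (cases "n ^ 3 * (n - 1) ^ 3 * S4 = 0")
    case False
    hence "n ^ 3 * (n - 1) ^ 3 * S4 > 0"
      using n S4 by (simp add: order_less_le)
    from main this show ?thesis
      by (simp add: pos_divide_le_eq)
  qed (use M in auto)
  hence "root 4 (q / (n ^ 3 * (n - 1) ^ 3) * (S2 ^ 4 / S4)) \<le> root 4 (M ^ 4)"
    by simp
  thus ?thesis
    using S2 M unfolding q_def S2_def S4_def
    by (simp only: real_root_mult real_root_divide real_root_power_cancel zero_less_numeral)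
qed

section \<open>Traces, triangular matrices and similarity\<close>

lemma mat_trace_mult_comm:
  fixes A B :: "'a :: comm_semiring_0 mat"
  assumes "A \<in> carrier_mat n m" "B \<in> carrier_mat m n"
  shows "mat_trace (A * B) = mat_trace (B * A)"
proof -
  have "mat_trace (A * B) = (\<Sum>i<n. \<Sum>j<m. A $$ (i, j) * B $$ (j, i))"
    using assms by (auto simp: mat_trace_def scalar_prod_def atLeast0LessThan intro!: sum.cong)
  also have "\<dots> = (\<Sum>j<m. \<Sum>i<n. B $$ (j, i) * A $$ (i, j))"
    by (subst sum.swap) (simp add: mult.commute)
  also have "\<dots> = mat_trace (B * A)"
    using assms by (auto simp: mat_trace_def scalar_prod_def atLeast0LessThan intro!: sum.cong)
  finally show ?thesis .
qed

text \<open>Cyclicity of the trace brings \<open>Q\<close> next to \<open>P\<close>, where they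
  cancel.\<close>

lemma mat_trace_similar:
  fixes A B :: "'a :: comm_semiring_1 mat"
  assumes "similar_mat_wit A B P Q"
  shows "mat_trace A = mat_trace B"
proof -
  define n where "n = dim_row A"
  note w = similar_mat_witD[OF n_def assms]
  have "mat_trace A = mat_trace (P * (B * Q))"
    by (simp only: w(3) assoc_mult_mat[OF w(6,5,7)])
  also have "\<dots> = mat_trace (B * Q * P)"
    by (rule mat_trace_mult_comm[OF w(6) mult_carrier_mat[OF w(5,7)]])
  also have "B * Q * P = B"
    using w(2,5) assoc_mult_mat[OF w(5,7,6)] by simp
  finally show ?thesis .
qed

lemma upper_triangular_mult:
  fixes A B :: "'a :: semiring_0 mat"
  assumes "A \<in> carrier_mat n n" "B \<in> carrier_mat n n" "upper_triangular A" "upper_triangular B"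
  shows "upper_triangular (A * B)"
    and "i < n \<Longrightarrow> (A * B) $$ (i, i) = A $$ (i, i) * B $$ (i, i)"
proof -
  have entry: "(A * B) $$ (i, j) = (\<Sum>k<n. A $$ (i, k) * B $$ (k, j))" if "i < n" "j < n" for i j
    using assms that by (simp add: scalar_prod_def atLeast0LessThan)
  have zero: "A $$ (i, k) * B $$ (k, j) = 0" if "i < n" "k < n" "k < i \<or> j < k" for i j k
    using assms that upper_triangularD[of A] upper_triangularD[of B] by auto
  show "upper_triangular (A * B)"
  proof (rule upper_triangularI)
    fix i j assume "j < i" "i < dim_row (A * B)"
    thus "(A * B) $$ (i, j) = 0"
      using assms by (subst entry) (auto intro!: sum.neutral zero)
  qed
  show "(A * B) $$ (i, i) = A $$ (i, i) * B $$ (i, i)" if "i < n"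
  proof -
    \<comment> \<open>The first factor vanishes for \<open>k < i\<close>, the second for
      \<open>i < k\<close>.\<close>
    have "(\<Sum>k<n. A $$ (i, k) * B $$ (k, i)) = (\<Sum>k\<in>{i}. A $$ (i, k) * B $$ (k, i))"
      using that by (intro sum.mono_neutral_right) (auto intro!: zero)
    thus ?thesis
      using that by (simp add: entry)
  qed
qed

text \<open>Both claims share one induction because the diagonal of a product is multiplicative only
  for triangular factors.\<close>

lemma upper_triangular_pow:
  fixes A :: "'a :: semiring_1 mat"
  assumes "A \<in> carrier_mat n n" "upper_triangular A"
  shows "upper_triangular (A ^\<^sub>m k) \<and> (\<forall>i<n. (A ^\<^sub>m k) $$ (i, i) = A $$ (i, i) ^ k)"
proof (induction k)
  case (Suc k)
  thus ?case
    using upper_triangular_mult[of "A ^\<^sub>m k" n A] assms by (simp add: power_commutes)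
qed (use assms in auto)

lemma mat_trace_pow_upper_triangular:
  fixes A :: "'a :: semiring_1 mat"
  assumes "A \<in> carrier_mat n n" "upper_triangular A"
  shows "mat_trace (A ^\<^sub>m k) = (\<Sum>i<n. A $$ (i, i) ^ k)"
  using upper_triangular_pow[OF assms, of k] assms(1) by (simp add: mat_trace_def)

text \<open>Schur decomposition, available because the characteristic polynomial splits over the
  complex numbers. Indexing by diagonal positions keeps multiplicities, which the traces
  need.\<close>

lemma complex_triangularization:
  fixes A :: "complex mat"
  assumes A: "A \<in> carrier_mat n n"
  obtains T P Q where "T \<in> carrier_mat n n" "upper_triangular T" "similar_mat_wit A T P Q"
    "spectrum A = (\<lambda>i. T $$ (i, i)) ` {..<n}"
proof -
  obtain es where "char_poly A = (\<Prod>a\<leftarrow>es. [:- a, 1:])"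
    using char_poly_factorized[OF A] by blast
  from schur_decomposition_exists[OF A this] obtain T
    where T: "T \<in> carrier_mat n n" "upper_triangular T" "similar_mat A T"
    by blast
  from T(3) obtain P Q where PQ: "similar_mat_wit A T P Q"
    unfolding similar_mat_def by blast
  have "char_poly A = (\<Prod>a\<leftarrow>diag_mat T. [:- a, 1:])"
    using char_poly_similar[OF T(3)] char_poly_upper_triangular[OF T(1,2)] by simp
  hence "spectrum A = set (diag_mat T)"
    unfolding spectrum_root_char_poly[OF A] by (auto simp: poly_prod_list prod_list_zero_iff)
  also have "\<dots> = (\<lambda>i. T $$ (i, i)) ` {..<n}"
    using T(1) by (auto simp: diag_mat_def)
  finally show thesis
    using that T PQ by blast
qed

text \<open>Scalar matrices commute with \<open>P\<close>, so the same \<open>P\<close> and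
  \<open>Q\<close> serve after the shift.\<close>

lemma similar_mat_wit_minus_smult_one:
  fixes A T :: "'a :: comm_ring_1 mat"
  assumes "similar_mat_wit A T P Q" "A \<in> carrier_mat n n"
  shows "similar_mat_wit (A - c \<cdot>\<^sub>m 1\<^sub>m n) (T - c \<cdot>\<^sub>m 1\<^sub>m n) P Q"
proof -
  note w = similar_mat_witD2[OF assms(2,1)]
  have "P * (T - c \<cdot>\<^sub>m 1\<^sub>m n) * Q = (P * T - c \<cdot>\<^sub>m P) * Q"
    using w by (subst mult_minus_distrib_mat[where nc = n])
      (auto simp: mult_smult_distrib[of P n n "1\<^sub>m n" n c])
  also have "\<dots> = P * T * Q - c \<cdot>\<^sub>m (P * Q)"
    using w by (subst minus_mult_distrib_mat[where nr = n and n = n])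
      (auto simp: mult_smult_assoc_mat[OF w(6,7)])
  also have "\<dots> = A - c \<cdot>\<^sub>m 1\<^sub>m n"
    using w by simp
  finally show ?thesis
    using w by (intro similar_mat_witI[where n = n]) auto
qed

theorem theorem3p1:
  fixes A B :: "complex mat" and n :: nat
  assumes "0 < n"
    and "A \<in> carrier_mat n n"
    and "\<And>z. eigenvalue A z \<Longrightarrow> z \<in> \<real>"
    and "B = A - (mat_trace A / of_nat n) \<cdot>\<^sub>m 1\<^sub>m n"
  shows "lambda_min A \<le> Re (mat_trace A) / real n
           - root 4 (((real n)^2 - 3 * real n + 3) / ((real n)^3 * (real n - 1)^3))
             * (Re (mat_trace (B ^\<^sub>m 2)) / root 4 (Re (mat_trace (B ^\<^sub>m 4))))
       \<and> lambda_max A \<ge> Re (mat_trace A) / real n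
           + root 4 (((real n)^2 - 3 * real n + 3) / ((real n)^3 * (real n - 1)^3))
             * (Re (mat_trace (B ^\<^sub>m 2)) / root 4 (Re (mat_trace (B ^\<^sub>m 4))))"
proof -
  obtain T P Q where T: "T \<in> carrier_mat n n" "upper_triangular T"
    and sim: "similar_mat_wit A T P Q" and spec: "spectrum A = (\<lambda>i. T $$ (i, i)) ` {..<n}"
    using complex_triangularization[OF assms(2)] by blast
  define c where "c = mat_trace A / of_nat n"
  \<comment> \<open>These are the eigenvalues of \<open>B\<close> with multiplicity;
    \<open>real\<close> and \<open>c\<close> below show that taking real parts loses
    nothing.\<close>
  define x where "x i = Re (T $$ (i, i)) - Re c" for i
  have real: "T $$ (i, i) = of_real (Re (T $$ (i, i)))" if "i < n" for i
  proof -
    have "eigenvalue A (T $$ (i, i))"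
      using spec that unfolding spectrum_def by blast
    thus ?thesis
      using assms(3) by simp
  qed
  have trA: "mat_trace A = (\<Sum>i<n. T $$ (i, i))"
    using mat_trace_similar[OF sim] T by (simp add: mat_trace_def)
  have "mat_trace A = of_real (\<Sum>i<n. Re (T $$ (i, i)))"
    unfolding trA of_real_sum using real by (intro sum.cong) auto
  hence c: "c = of_real (Re c)"
    unfolding c_def by simp
  have Re_c: "Re c = Re (mat_trace A) / real n"
    unfolding c_def by simp
  have "(\<Sum>i<n. x i) = Re (mat_trace A) - real n * Re c"
    unfolding x_def trA by (simp add: sum_subtractf)
  hence sum0: "(\<Sum>i<n. x i) = 0"
    using assms(1) unfolding Re_c by simp
  have simB: "similar_mat_wit B (T - c \<cdot>\<^sub>m 1\<^sub>m n) P Q"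
    unfolding assms(4) c_def[symmetric] by (rule similar_mat_wit_minus_smult_one[OF sim assms(2)])
  \<comment> \<open>Powers of \<open>B\<close> are similar to powers of the shifted
    \<open>T\<close>, which is triangular with diagonal \<open>x\<close>.\<close>
  have trB: "Re (mat_trace (B ^\<^sub>m k)) = (\<Sum>i<n. x i ^ k)" for k
  proof -
    have "mat_trace (B ^\<^sub>m k) = mat_trace ((T - c \<cdot>\<^sub>m 1\<^sub>m n) ^\<^sub>m k)"
      by (rule mat_trace_similar[OF similar_mat_wit_pow[OF simB]])
    also have "\<dots> = (\<Sum>i<n. (T - c \<cdot>\<^sub>m 1\<^sub>m n) $$ (i, i) ^ k)"
      using T upper_triangularD[OF T(2)]
      by (intro mat_trace_pow_upper_triangular upper_triangularI) auto
    also have "\<dots> = (\<Sum>i<n. of_real (x i ^ k))"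
    proof (intro sum.cong refl)
      fix i assume "i \<in> {..<n}"
      hence "(T - c \<cdot>\<^sub>m 1\<^sub>m n) $$ (i, i) = T $$ (i, i) - c"
        using T by simp
      also have "\<dots> = of_real (x i)"
        using real[of i] c \<open>i \<in> {..<n}\<close> unfolding x_def by (metis lessThan_iff of_real_diff)
      finally show "(T - c \<cdot>\<^sub>m 1\<^sub>m n) $$ (i, i) ^ k = of_real (x i ^ k)"
        by simp
    qed
    finally show ?thesis
      by simp
  qed
  have Re_spec: "Re ` spectrum A = (\<lambda>i. x i + Re c) ` {..<n}"
    unfolding spec x_def by (simp add: image_image)
  have max: "x i \<le> lambda_max A - Re c" and min: "- x i \<le> Re c - lambda_min A" if "i < n" for i
  proof -
    have "finite (Re ` spectrum A)" "x i + Re c \<in> Re ` spectrum A"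
      unfolding Re_spec using that by auto
    thus "x i \<le> lambda_max A - Re c" "- x i \<le> Re c - lambda_min A"
      unfolding lambda_max_def lambda_min_def
      using Max_ge[of "Re ` spectrum A" "x i + Re c"] Min_le[of "Re ` spectrum A" "x i + Re c"]
      by linarith+
  qed
  have ne: "{..<n} \<noteq> {}"
    using assms(1) by blast
  let ?C = "root 4 (((real n)\<^sup>2 - 3 * real n + 3) / (real n ^ 3 * (real n - 1) ^ 3))
    * ((\<Sum>i<n. x i ^ 2) / root 4 (\<Sum>i<n. x i ^ 4))"
  have "?C \<le> lambda_max A - Re c"
    using upper_bound_of_sum_zero_ge[OF finite_lessThan ne sum0 max] by simp
  \<comment> \<open>Negating \<open>x\<close> leaves the even power sums, and hence
    \<open>?C\<close>, unchanged.\<close>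
  moreover have "?C \<le> Re c - lambda_min A"
    using upper_bound_of_sum_zero_ge[OF finite_lessThan ne, of "\<lambda>i. - x i" "Re c - lambda_min A"]
      sum0 min by (simp add: sum_negf)
  ultimately show ?thesis
    unfolding trB Re_c by linarith
qed

end
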